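(* Let $n \ge 2$ be an integer, let $m$ be a positive integer with $m \equiv 1 \pmod{n}$, and let $c>0$ be a real number. Then $$\beta^n_m(c^n, c) = c.$$
   Context: For positive integers $n, m$ and real numbers $x>0$, $c>0$, the (binomial) biroot approximant of root index $n$ and order $m$ is $$\beta^n_m(x,c) = \frac{\displaystyle\sum_{k=0}^{\lceil m/n \rceil} x^k\, c^{m-nk} \binom{m}{nk}}{\displaystyle\sum_{k=0}^{\lceil m/n \rceil - 1} x^k\, c^{m-nk-1} \binom{m}{nk+1}}.$$ Binomial coefficients $\binom{a}{b}$ with $b>a\ge 0$ are equal to $0$. Exponents of $c$ are integers and may be negative (in which case the binomial coefficient vanishes). *)

theory Defs
  imports Complex_Main "HOL-Number_Theory.Cong"
begin

text \<open>
  The binomial biroot approximant of root index \<open>n\<close> and order \<open>m\<close>, meant for \<open>n, m > 0\<close> and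
  \<open>x, c > 0\<close>. The exponents of \<open>c\<close> are integers and may be negative, hence \<open>powi\<close>; the
  corresponding binomial coefficients are then \<open>0\<close>. The range \<open>k < N\<close> in the denominator
  is \<open>0 \<le> k \<le> N - 1\<close>.
\<close>

definition biroot :: "nat \<Rightarrow> nat \<Rightarrow> real \<Rightarrow> real \<Rightarrow> real" where
  "biroot n m x c =
    (\<Sum>k\<le>nat \<lceil>real m / real n\<rceil>.
        x ^ k * c powi (int m - int (n * k)) * real (m choose (n * k))) /
    (\<Sum>k<nat \<lceil>real m / real n\<rceil>.
        x ^ k * c powi (int m - int (n * k) - 1) * real (m choose (n * k + 1)))"

end

theory Submission
  imports Defs
begin

text \<open>
  At \<open>x = c ^ n\<close> every term of the numerator carries the factor \<open>c ^ m\<close> and every term of the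
  denominator the factor \<open>c ^ (m - 1)\<close>, so \<open>c\<close> is multiplied by a quotient of two sums of binomial
  coefficients. For \<open>m = n * q + 1\<close> the symmetry of the binomial coefficients under
  \<open>k \<mapsto> q - k\<close> identifies these two sums.
\<close>

lemma sum_choose_mult_eq_sum_choose_mult_plus1:
  "(\<Sum>k\<le>q. (n * q + 1) choose (n * k)) = (\<Sum>k\<le>q. (n * q + 1) choose (n * k + 1))"
proof -
  have "(\<Sum>k\<le>q. (n * q + 1) choose (n * k)) = (\<Sum>k\<le>q. (n * q + 1) choose (n * (q - k)))"
    by (rule sum.nat_diff_reindex[of _ "Suc q", simplified lessThan_Suc_atMost, simplified, symmetric])
  also have "\<dots> = (\<Sum>k\<le>q. (n * q + 1) choose (n * k + 1))"
  proof (rule sum.cong[OF refl])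
    fix k assume "k \<in> {..q}"
    \<comment> \<open>The lower indices \<open>n * (q - k)\<close> and \<open>n * k + 1\<close> add
      up to \<open>n * q + 1\<close>.\<close>
    then have "n * k + 1 \<le> n * q + 1" "n * q + 1 - (n * k + 1) = n * (q - k)"
      by (simp_all add: diff_mult_distrib2)
    then show "(n * q + 1) choose (n * (q - k)) = (n * q + 1) choose (n * k + 1)"
      by (metis binomial_symmetric)
  qed
  finally show ?thesis .
qed

text \<open>Integer exponents cover the top term of the numerator too, where
  \<open>m - n * (q + 1) = 1 - n\<close> is negative.\<close>

lemma power_mult_powi_diff:
  fixes c :: "'a :: field"
  assumes "c \<noteq> 0"
  shows "(c ^ n) ^ k * c powi (i - int (n * k)) = c powi i"
  using assms by (simp add: power_int_diff power_int_mult)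

theorem theorem3p6:
  fixes n m :: nat and c :: real
  assumes "n \<ge> 2" and "m > 0" and "[m = 1] (mod n)" and "c > 0"
  shows "biroot n m (c ^ n) c = c"
proof -
  have "n dvd m - 1"
    using assms by (simp add: cong_altdef_nat)
  then obtain q where "m - 1 = n * q" ..
  then have m: "m = n * q + 1"
    using \<open>m > 0\<close> by simp
  have "real m / real n = real q + 1 / real n"
    using \<open>n \<ge> 2\<close> by (simp add: m field_simps)
  moreover have "0 < 1 / real n" "1 / real n \<le> 1"
    using \<open>n \<ge> 2\<close> by auto
  ultimately have "\<lceil>real m / real n\<rceil> = int q + 1"
    by (intro ceiling_unique) auto
  then have N: "nat \<lceil>real m / real n\<rceil> = Suc q"
    by simp
  define S where "S = (\<Sum>k\<le>q. m choose (n * k + 1))"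
  \<comment> \<open>The term at \<open>k = 0\<close> is \<open>m\<close>, so the common sum
    \<open>S\<close> is positive and can be cancelled.\<close>
  have "m choose (n * 0 + 1) \<le> S"
    unfolding S_def by (rule member_le_sum) auto
  then have "S > 0"
    using \<open>m > 0\<close> by simp
  \<comment> \<open>The ceiling gives the numerator one index more than the denominator,
    \<open>k = q + 1\<close>; its binomial coefficient vanishes because \<open>n * (q + 1)\<close>
    exceeds \<open>m\<close>.\<close>
  have "m < n * Suc q"
    using \<open>n \<ge> 2\<close> by (simp add: m)
  then have "(\<Sum>k\<le>Suc q. m choose (n * k)) = S"
    using sum_choose_mult_eq_sum_choose_mult_plus1[of n q]
    by (simp add: S_def m binomial_eq_0)
  then have num: "(\<Sum>k\<le>Suc q. (c ^ n) ^ k * c powi (int m - int (n * k)) * real (m choose (n * k)))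
      = c powi int m * real S"
    using \<open>c > 0\<close>
    by (simp only: power_mult_powi_diff flip: sum_distrib_left of_nat_sum)
  have "(\<Sum>k<Suc q. (c ^ n) ^ k * c powi (int m - int (n * k) - 1) * real (m choose (n * k + 1)))
      = (\<Sum>k\<le>q. c powi (int m - 1) * real (m choose (n * k + 1)))"
    using \<open>c > 0\<close> power_mult_powi_diff[of c n _ "int m - 1"]
    by (simp add: lessThan_Suc_atMost algebra_simps)
  then have den: "(\<Sum>k<Suc q. (c ^ n) ^ k * c powi (int m - int (n * k) - 1) * real (m choose (n * k + 1)))
      = c powi (int m - 1) * real S"
    by (simp add: S_def sum_distrib_left)
  show ?thesis
    unfolding biroot_def N num den
    using \<open>c > 0\<close> \<open>S > 0\<close> by (simp add: power_int_diff)
qed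

end
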